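(* Let $B$ be a locale. The category $B\text{-}\mathbf{Loc}$ of $B$-locales and maps of $B$-locales is isomorphic to the slice category $\mathbf{Loc}/B$.
   Context: A locale is a frame: a complete lattice in which finite meets distribute over arbitrary joins, with least element $0$ and greatest element $1$. A homomorphism of locales preserves arbitrary joins and finite meets (including $0$ and $1$). A (continuous) map of locales $f:X\to Y$ is, by definition, a homomorphism of locales $f^*:Y\to X$ in the opposite direction. $\mathbf{Loc}$ is the category of locales and maps; $\mathbf{Loc}/B$ is its slice category over $B$. A $B$-module is a complete lattice $X$ with an action $B\times X\to X$, $(b,x)\mapsto bx$, preserving arbitrary joins in each variable separately and satisfying $1x=x$ and $(b\wedge c)x=b(cx)$. A homomorphism of $B$-modules preserves arbitrary joins and the action. A $B$-locale is a locale $X$ equipped with a structure of $B$-module (on its underlying complete lattice) such that $bx=b1\wedge x$ for all $b\in B$, $x\in X$ (here $b1$ is the action of $b$ on the greatest element $1\in X$). A homomorphism of $B$-locales is a homomorphism of locales that is also a homomorphism of $B$-modules. A map of $B$-locales $f:X\to Y$ is a homomorphism of $B$-locales $f^*:Y\to X$. $B\text{-}\mathbf{Loc}$ is the category of $B$-locales and maps of $B$-locales. *)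

theory Defs
  imports "HOL-Algebra.Complete_Lattice"
begin

section \<open>Categories, functors, isomorphism of categories\<close>

text \<open>
  Arrows are typed by their source and target: \<open>Hom C X Y\<close> is the set of arrows from \<open>X\<close> to
  \<open>Y\<close>, and the hom-sets of different pairs of objects need not be disjoint as sets. Therefore
  composition, and the action of a functor on arrows, take the objects as arguments.
  \<open>Comp C X Y Z g f\<close> is the composite of \<open>f\<close> from \<open>X\<close> to \<open>Y\<close> followed by \<open>g\<close> from \<open>Y\<close> to \<open>Z\<close>.
\<close>

record ('o, 'm) cat =
  Ob :: "'o set"
  Hom :: "'o \<Rightarrow> 'o \<Rightarrow> 'm set"
  Ident :: "'o \<Rightarrow> 'm"
  Comp :: "'o \<Rightarrow> 'o \<Rightarrow> 'o \<Rightarrow> 'm \<Rightarrow> 'm \<Rightarrow> 'm"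

locale category =
  fixes C :: "('o, 'm) cat"
  assumes Ident_in_Hom: "X \<in> Ob C \<Longrightarrow> Ident C X \<in> Hom C X X"
    and Comp_in_Hom:
      "\<lbrakk>X \<in> Ob C; Y \<in> Ob C; Z \<in> Ob C; f \<in> Hom C X Y; g \<in> Hom C Y Z\<rbrakk>
        \<Longrightarrow> Comp C X Y Z g f \<in> Hom C X Z"
    and Comp_Ident_right:
      "\<lbrakk>X \<in> Ob C; Y \<in> Ob C; f \<in> Hom C X Y\<rbrakk> \<Longrightarrow> Comp C X X Y f (Ident C X) = f"
    and Comp_Ident_left:
      "\<lbrakk>X \<in> Ob C; Y \<in> Ob C; f \<in> Hom C X Y\<rbrakk> \<Longrightarrow> Comp C X Y Y (Ident C Y) f = f"
    and Comp_assoc: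
      "\<lbrakk>W \<in> Ob C; X \<in> Ob C; Y \<in> Ob C; Z \<in> Ob C;
        f \<in> Hom C W X; g \<in> Hom C X Y; h \<in> Hom C Y Z\<rbrakk>
        \<Longrightarrow> Comp C W X Z (Comp C X Y Z h g) f = Comp C W Y Z h (Comp C W X Y g f)"

locale cat_functor = C: category C + D: category D
  for C :: "('o, 'm) cat" and D :: "('p, 'n) cat" +
  fixes Fo :: "'o \<Rightarrow> 'p" and Fa :: "'o \<Rightarrow> 'o \<Rightarrow> 'm \<Rightarrow> 'n"
  assumes Fo_in_Ob: "X \<in> Ob C \<Longrightarrow> Fo X \<in> Ob D"
    and Fa_in_Hom:
      "\<lbrakk>X \<in> Ob C; Y \<in> Ob C; f \<in> Hom C X Y\<rbrakk> \<Longrightarrow> Fa X Y f \<in> Hom D (Fo X) (Fo Y)"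
    and Fa_Ident: "X \<in> Ob C \<Longrightarrow> Fa X X (Ident C X) = Ident D (Fo X)"
    and Fa_Comp:
      "\<lbrakk>X \<in> Ob C; Y \<in> Ob C; Z \<in> Ob C; f \<in> Hom C X Y; g \<in> Hom C Y Z\<rbrakk>
        \<Longrightarrow> Fa X Z (Comp C X Y Z g f) = Comp D (Fo X) (Fo Y) (Fo Z) (Fa Y Z g) (Fa X Y f)"

definition isomorphic_cats :: "('o, 'm) cat \<Rightarrow> ('p, 'n) cat \<Rightarrow> bool" where
  "isomorphic_cats C D \<longleftrightarrow>
    (\<exists>Fo Fa Go Ga.
      cat_functor C D Fo Fa \<and> cat_functor D C Go Ga \<and>
      (\<forall>X\<in>Ob C. Go (Fo X) = X) \<and>
      (\<forall>X\<in>Ob C. \<forall>Y\<in>Ob C. \<forall>f\<in>Hom C X Y. Ga (Fo X) (Fo Y) (Fa X Y f) = f) \<and>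
      (\<forall>X\<in>Ob D. Fo (Go X) = X) \<and>
      (\<forall>X\<in>Ob D. \<forall>Y\<in>Ob D. \<forall>f\<in>Hom D X Y. Fa (Go X) (Go Y) (Ga X Y f) = f))"

definition slice :: "('o, 'm) cat \<Rightarrow> 'o \<Rightarrow> ('o \<times> 'm, 'm) cat" where
  "slice C B =
    \<lparr>Ob = (SIGMA X : Ob C. Hom C X B),
     Hom = (\<lambda>(X, p) (Y, q). {f \<in> Hom C X Y. Comp C X Y B q f = p}),
     Ident = (\<lambda>(X, p). Ident C X),
     Comp = (\<lambda>(X, p) (Y, q) (Z, r). Comp C X Y Z)\<rparr>"

section \<open>Locales and their maps\<close>

text \<open>
  A locale in the sense of point-free topology is called a frame here. The last assumption says
  that the order is a relation on the carrier; without it, frames that differ only in irrelevant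
  values of \<open>le\<close> off the carrier would be different objects. For the same reason homomorphisms
  and actions below are extensional functions.
\<close>

locale frame = complete_lattice L for L (structure) +
  assumes meet_sup_distrib:
      "\<lbrakk>x \<in> carrier L; A \<subseteq> carrier L\<rbrakk> \<Longrightarrow> x \<sqinter> (\<Squnion>A) = \<Squnion>((\<lambda>a. x \<sqinter> a) ` A)"
    and le_on_carrier: "x \<sqsubseteq> y \<Longrightarrow> x \<in> carrier L \<and> y \<in> carrier L"

text \<open>Preservation of the least element is the case of the empty join in \<^const>\<open>sup_pres\<close>.\<close>

definition frame_homs ::
  "('a, 'c) gorder_scheme \<Rightarrow> ('b, 'd) gorder_scheme \<Rightarrow> ('a \<Rightarrow> 'b) set" where
  "frame_homs X Y =
    {h \<in> carrier X \<rightarrow>\<^sub>E carrier Y. sup_pres X Y h \<and> meet_pres X Y h \<and> h \<top>\<^bsub>X\<^esub> = \<top>\<^bsub>Y\<^esub>}"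

text \<open>
  An arrow from \<open>X\<close> to \<open>Y\<close> is represented by its inverse image homomorphism from \<open>Y\<close> to \<open>X\<close>,
  so composition is reversed. The objects are all frames whose carrier is a subset of the type
  \<open>'a\<close>, which plays the role of the universe.
\<close>

definition Loc :: "('a gorder, 'a \<Rightarrow> 'a) cat" where
  "Loc =
    \<lparr>Ob = {X. frame X},
     Hom = (\<lambda>X Y. frame_homs Y X),
     Ident = (\<lambda>X. \<lambda>x\<in>carrier X. x),
     Comp = (\<lambda>X Y Z g f. compose (carrier Z) f g)\<rparr>"

section \<open>Modules and locales over a base\<close>

record ('b, 'a) act_order = "'a gorder" +
  act :: "'b \<Rightarrow> 'a \<Rightarrow> 'a"

locale frame_module = B: frame B + complete_lattice X
  for B :: "'b gorder" and X :: "('b, 'a) act_order" +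
  assumes act_ext: "act X \<in> carrier B \<rightarrow>\<^sub>E carrier X \<rightarrow>\<^sub>E carrier X"
    and act_sup_left:
      "\<lbrakk>S \<subseteq> carrier B; x \<in> carrier X\<rbrakk> \<Longrightarrow> act X (\<Squnion>\<^bsub>B\<^esub>S) x = \<Squnion>\<^bsub>X\<^esub>((\<lambda>b. act X b x) ` S)"
    and act_sup_right:
      "\<lbrakk>b \<in> carrier B; A \<subseteq> carrier X\<rbrakk> \<Longrightarrow> act X b (\<Squnion>\<^bsub>X\<^esub>A) = \<Squnion>\<^bsub>X\<^esub>(act X b ` A)"
    and act_top: "x \<in> carrier X \<Longrightarrow> act X \<top>\<^bsub>B\<^esub> x = x"
    and act_meet:
      "\<lbrakk>b \<in> carrier B; c \<in> carrier B; x \<in> carrier X\<rbrakk>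
        \<Longrightarrow> act X (b \<sqinter>\<^bsub>B\<^esub> c) x = act X b (act X c x)"

definition frame_module_homs ::
  "'b gorder \<Rightarrow> ('b, 'a) act_order \<Rightarrow> ('b, 'c) act_order \<Rightarrow> ('a \<Rightarrow> 'c) set" where
  "frame_module_homs B X Y =
    {h \<in> carrier X \<rightarrow>\<^sub>E carrier Y. sup_pres X Y h \<and>
      (\<forall>b\<in>carrier B. \<forall>x\<in>carrier X. h (act X b x) = act Y b (h x))}"

locale frame_over = frame_module B X + frame X
  for B :: "'b gorder" and X :: "('b, 'a) act_order" +
  assumes act_eq_meet:
    "\<lbrakk>b \<in> carrier B; x \<in> carrier X\<rbrakk> \<Longrightarrow> act X b x = act X b \<top>\<^bsub>X\<^esub> \<sqinter>\<^bsub>X\<^esub> x"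

definition BLoc :: "'b gorder \<Rightarrow> (('b, 'a) act_order, 'a \<Rightarrow> 'a) cat" where
  "BLoc B =
    \<lparr>Ob = {X. frame_over B X},
     Hom = (\<lambda>X Y. frame_homs Y X \<inter> frame_module_homs B Y X),
     Ident = (\<lambda>X. \<lambda>x\<in>carrier X. x),
     Comp = (\<lambda>X Y Z g f. compose (carrier Z) f g)\<rparr>"

end

theory Submission
  imports Defs
begin

text \<open>
  A \<open>B\<close>-locale structure on \<open>X\<close> is determined by the homomorphism \<open>b \<mapsto> b1\<close> from \<open>B\<close> to \<open>X\<close>,
  because \<open>bx = b1 \<sqinter> x\<close>. Conversely, a homomorphism \<open>p\<close> from \<open>B\<close> to \<open>X\<close> gives the action
  \<open>bx = p b \<sqinter> x\<close>. A frame homomorphism \<open>h\<close> commutes with the actions iff it commutes with the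
  structure homomorphisms: take \<open>x = 1\<close> in one direction and use preservation of meets in the
  other. Hence both functors leave arrows unchanged.
\<close>

section \<open>Slice categories\<close>

lemma category_slice:
  assumes "category C" and B: "B \<in> Ob C"
  shows "category (slice C B)"
proof -
  interpret category C by fact
  \<comment> \<open>Commuting triangles over \<open>B\<close> paste by associativity, so composites
    of slice arrows are slice arrows. The category laws themselves are inherited from
    \<open>C\<close>.\<close>
  have "Comp C X Z B r (Comp C X Y Z g f) = Comp C X Y B q f"
    if "X \<in> Ob C" "Y \<in> Ob C" "Z \<in> Ob C" "f \<in> Hom C X Y" "g \<in> Hom C Y Z" "r \<in> Hom C Z B"
      "Comp C Y Z B r g = q" for X Y Z f g q r
    using Comp_assoc[OF that(1-3) B that(4-6)] that(7) by simp
  then show ?thesis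
    by unfold_locales
      (auto simp: slice_def Ident_in_Hom Comp_in_Hom Comp_Ident_left Comp_Ident_right B
        intro: Comp_assoc)
qed

section \<open>Frames and their homomorphisms\<close>

lemma (in frame) sup_meet_distrib:
  assumes "x \<in> carrier L" "A \<subseteq> carrier L"
  shows "(\<Squnion>A) \<sqinter> x = \<Squnion>((\<lambda>a. a \<sqinter> x) ` A)"
  using meet_sup_distrib[OF assms] by (simp add: meet_comm[of L x])

lemma (in frame) meet_top:
  assumes "x \<in> carrier L"
  shows "x \<sqinter> \<top> = x"
  using top_meet[OF assms] by (simp add: eq_is_equal meet_comm[of L x])

lemma ident_in_frame_homs:
  assumes "frame X"
  shows "(\<lambda>x\<in>carrier X. x) \<in> frame_homs X X"
proof -
  interpret frame X by fact
  have "(\<lambda>x\<in>carrier X. x) ` A = A" if "A \<subseteq> carrier X" for A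
    using that by (auto simp: image_iff)
  then show ?thesis
    by (auto simp: frame_homs_def sup_pres_def meet_pres_def
        complete_lattice_axioms lattice_axioms)
qed

lemma compose_image:
  assumes "A \<subseteq> S"
  shows "compose S g f ` A = g ` f ` A"
  using assms by (force simp: compose_def)

text \<open>Shared by frame and module homomorphisms. Since \<open>f\<close> maps into
  \<open>carrier Y\<close>, \<open>sup_pres Y Z g\<close> applies to the image of a set under
  \<open>f\<close>.\<close>

lemma sup_pres_compose:
  assumes "f \<in> carrier X \<rightarrow> carrier Y" "sup_pres X Y f" "sup_pres Y Z g"
  shows "sup_pres X Z (compose (carrier X) g f)"
proof -
  interpret X: complete_lattice X using assms(2) by (simp add: sup_pres_def)
  have "f ` A \<subseteq> carrier Y" if "A \<subseteq> carrier X" for A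
    using that assms(1) by auto
  then show ?thesis
    using assms(2,3) by (auto simp: sup_pres_def compose_image compose_eq)
qed

lemma frame_homs_compose:
  assumes f: "f \<in> frame_homs X Y" and g: "g \<in> frame_homs Y Z"
  shows "compose (carrier X) g f \<in> frame_homs X Z"
proof -
  interpret X: complete_lattice X
    using f by (simp add: frame_homs_def sup_pres_def)
  have "f x \<in> carrier Y" if "x \<in> carrier X" for x
    using f that by (auto simp: frame_homs_def)
  moreover have "sup_pres X Z (compose (carrier X) g f)"
    using f g by (intro sup_pres_compose) (auto simp: frame_homs_def)
  ultimately show ?thesis
    using f g by (auto simp: frame_homs_def meet_pres_def compose_eq)
      (auto simp: compose_def)
qed

lemma frame_homsD:
  assumes "h \<in> frame_homs X Y"
  shows "h \<in> carrier X \<rightarrow>\<^sub>E carrier Y"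
  using assms by (simp add: frame_homs_def)

text \<open>Extensionality of \<open>f\<close> makes the unit law an equality of functions: off
  \<open>S\<close> both sides are \<open>undefined\<close>.\<close>

lemma compose_ident_right:
  assumes "f \<in> S \<rightarrow>\<^sub>E T"
  shows "compose S f (\<lambda>x\<in>S. x) = f"
  using assms by (auto simp: compose_def fun_eq_iff PiE_def extensional_def)

lemma compose_ident_left:
  assumes "f \<in> S \<rightarrow>\<^sub>E T"
  shows "compose S (\<lambda>x\<in>T. x) f = f"
  using assms by (auto simp: compose_def fun_eq_iff PiE_def extensional_def)

lemma category_Loc: "category Loc"
  by unfold_locales
    (auto simp: Loc_def ident_in_frame_homs frame_homs_compose
      intro: compose_ident_right compose_ident_left compose_assoc Pi_I PiE_mem dest!: frame_homsD)

section \<open>Locales over a base\<close>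

lemma frame_module_homs_compose:
  assumes f: "f \<in> frame_module_homs B X Y" and g: "g \<in> frame_module_homs B Y Z"
    and "frame_module B X"
  shows "compose (carrier X) g f \<in> frame_module_homs B X Z"
proof -
  interpret X: frame_module B X by fact
  have "f x \<in> carrier Y" if "x \<in> carrier X" for x
    using f that by (auto simp: frame_module_homs_def)
  \<comment> \<open>\<open>compose\<close> is \<open>undefined\<close> off \<open>carrier X\<close>,
    so evaluating it at \<open>act X b x\<close> requires closure under the action.\<close>
  moreover have "act X b x \<in> carrier X" if "b \<in> carrier B" "x \<in> carrier X" for b x
    using X.act_ext that by (auto dest!: PiE_mem)
  moreover have "sup_pres X Z (compose (carrier X) g f)"
    using f g by (intro sup_pres_compose) (auto simp: frame_module_homs_def)
  ultimately show ?thesis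
    using f g by (auto simp: frame_module_homs_def compose_eq) (auto simp: compose_def)
qed

lemma ident_in_frame_module_homs:
  assumes "frame_over B X"
  shows "(\<lambda>x\<in>carrier X. x) \<in> frame_module_homs B X X"
proof -
  interpret X: frame_over B X by fact
  have "act X b x \<in> carrier X" if "b \<in> carrier B" "x \<in> carrier X" for b x
    using X.act_ext that by (auto dest!: PiE_mem)
  moreover have "sup_pres X X (\<lambda>x\<in>carrier X. x)"
    using ident_in_frame_homs[OF X.frame_axioms] by (simp add: frame_homs_def)
  ultimately show ?thesis
    by (auto simp: frame_module_homs_def)
qed

lemma category_BLoc: "category (BLoc B)"
proof -
  have BLoc: "Ob (BLoc B) = {X. frame_over B X}"
    "Hom (BLoc B) X Y = frame_homs Y X \<inter> frame_module_homs B Y X"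
    "Ident (BLoc B) X = (\<lambda>x\<in>carrier X. x)"
    "Comp (BLoc B) X Y Z g f = compose (carrier Z) f g" for X Y Z f g
    by (simp_all add: BLoc_def)
  show ?thesis
  proof (intro category.intro; unfold BLoc; (elim CollectE IntE)?; (intro IntI)?)
    fix X assume "frame_over B X"
    then show "(\<lambda>x\<in>carrier X. x) \<in> frame_homs X X"
      by (intro ident_in_frame_homs) (rule frame_over.axioms)
  qed (auto intro: ident_in_frame_module_homs frame_homs_compose frame_module_homs_compose
      compose_ident_left compose_ident_right compose_assoc frame_over.axioms Pi_I
      dest: PiE_mem frame_homsD)
qed

section \<open>Forgetting the action\<close>

text \<open>The order-theoretic notions depend only on \<open>carrier\<close>, \<open>le\<close> and
  \<open>eq\<close>, so dropping the field \<open>act\<close> changes none of them. The rules of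
  this section transfer them step by step, up to frame homomorphisms.\<close>

lemma carrier_truncate [simp]: "carrier (gorder.truncate X) = carrier X"
  and le_truncate [simp]: "le (gorder.truncate X) = le X"
  and eq_truncate [simp]: "eq (gorder.truncate X) = eq X"
  by (simp_all add: gorder.defs)

lemma sup_truncate [simp]: "\<Squnion>\<^bsub>gorder.truncate X\<^esub>A = \<Squnion>\<^bsub>X\<^esub>A"
  and inf_truncate [simp]: "\<Sqinter>\<^bsub>gorder.truncate X\<^esub>A = \<Sqinter>\<^bsub>X\<^esub>A"
  and top_truncate [simp]: "\<top>\<^bsub>gorder.truncate X\<^esub> = \<top>\<^bsub>X\<^esub>"
  by (simp_all add: sup_def inf_def top_def least_def greatest_def Upper_def Lower_def)

lemma meet_truncate [simp]: "x \<sqinter>\<^bsub>gorder.truncate X\<^esub> y = x \<sqinter>\<^bsub>X\<^esub> y"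
  by (simp add: meet_def)

lemma partial_order_truncate [simp]: "partial_order (gorder.truncate X) = partial_order X"
  by (simp add: partial_order_def partial_order_axioms_def weak_partial_order_def
      weak_partial_order_axioms_def equivalence_def)

lemma lattice_truncate [simp]: "lattice (gorder.truncate X) = lattice X"
  by (simp add: lattice_def upper_semilattice_def upper_semilattice_axioms_def
      lower_semilattice_def lower_semilattice_axioms_def least_def greatest_def
      Upper_def Lower_def)

lemma complete_lattice_truncate [simp]:
  "complete_lattice (gorder.truncate X) = complete_lattice X"
  by (simp add: complete_lattice_def complete_lattice_axioms_def least_def greatest_def
      Upper_def Lower_def)

lemma frame_truncate [simp]: "frame (gorder.truncate X) = frame X"
  by (simp add: frame_def frame_axioms_def)

lemma frame_homs_truncate_left [simp]:
  "frame_homs (gorder.truncate X) Y = frame_homs X Y"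
  by (simp add: frame_homs_def sup_pres_def meet_pres_def)

lemma frame_homs_truncate_right [simp]:
  "frame_homs X (gorder.truncate Y) = frame_homs X Y"
  by (simp add: frame_homs_def sup_pres_def meet_pres_def)

section \<open>Actions and structure homomorphisms\<close>

text \<open>Read in \<open>Loc\<close>, this inverse image is the arrow from \<open>X\<close> to
  \<open>B\<close> that makes \<open>X\<close> an object of the slice.\<close>

definition structure_hom :: "'b gorder \<Rightarrow> ('b, 'a) act_order \<Rightarrow> 'b \<Rightarrow> 'a" where
  "structure_hom B X = (\<lambda>b\<in>carrier B. act X b \<top>\<^bsub>X\<^esub>)"

text \<open>The nested restrictions make the action extensional in each argument, as
  \<open>act_ext\<close> demands.\<close>

definition with_action :: "'b gorder \<Rightarrow> 'a gorder \<Rightarrow> ('b \<Rightarrow> 'a) \<Rightarrow> ('b, 'a) act_order" where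
  "with_action B X p =
    \<lparr>carrier = carrier X, eq = eq X, le = le X,
     act = (\<lambda>b\<in>carrier B. \<lambda>x\<in>carrier X. p b \<sqinter>\<^bsub>X\<^esub> x)\<rparr>"

lemma truncate_with_action [simp]: "gorder.truncate (with_action B X p) = X"
  by (simp add: with_action_def gorder.defs)

lemma with_action_simps [simp]:
  "carrier (with_action B X p) = carrier X"
  "act (with_action B X p) = (\<lambda>b\<in>carrier B. \<lambda>x\<in>carrier X. p b \<sqinter>\<^bsub>X\<^esub> x)"
  by (simp_all add: with_action_def)

text \<open>Instances of the truncation rules, since the truncation of
  \<open>with_action B X p\<close> is \<open>X\<close>.\<close>

lemma order_with_action [simp]:
  "\<Squnion>\<^bsub>with_action B X p\<^esub>A = \<Squnion>\<^bsub>X\<^esub>A"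
  "x \<sqinter>\<^bsub>with_action B X p\<^esub> y = x \<sqinter>\<^bsub>X\<^esub> y"
  "\<top>\<^bsub>with_action B X p\<^esub> = \<top>\<^bsub>X\<^esub>"
  "complete_lattice (with_action B X p) = complete_lattice X"
  "frame (with_action B X p) = frame X"
  by (metis truncate_with_action sup_truncate meet_truncate top_truncate
      complete_lattice_truncate frame_truncate)+

lemma frame_homs_with_action [simp]:
  "frame_homs (with_action B X p) (with_action B Y q) = frame_homs X Y"
  by (metis truncate_with_action frame_homs_truncate_left frame_homs_truncate_right)

text \<open>Joins and the greatest element are preserved by \<open>act_sup_left\<close> and
  \<open>act_top\<close> at 1. For meets, (b \<sqinter> c)1 = b(c1) = b1 \<sqinter> c1, where the
  last equation is \<open>act_eq_meet\<close> at x = c1.\<close>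

lemma structure_hom_in_frame_homs:
  assumes "frame_over B X"
  shows "structure_hom B X \<in> frame_homs B X"
proof -
  interpret X: frame_over B X by fact
  have closed: "act X b x \<in> carrier X" if "b \<in> carrier B" "x \<in> carrier X" for b x
    using X.act_ext that by (auto dest!: PiE_mem)
  have img: "structure_hom B X ` S = (\<lambda>b. act X b \<top>\<^bsub>X\<^esub>) ` S" if "S \<subseteq> carrier B" for S
    using that by (force simp: structure_hom_def)
  show ?thesis
    unfolding frame_homs_def sup_pres_def meet_pres_def
    by (auto simp: img X.act_sup_left X.B.complete_lattice_axioms X.complete_lattice_axioms
        X.B.lattice_axioms X.lattice_axioms)
      (auto simp: structure_hom_def closed X.act_sup_left X.act_meet X.act_top
        X.act_eq_meet[symmetric])
qed

text \<open>Joins in x are preserved by distributivity, joins in b by distributivity and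
  \<open>p_sup\<close>. The unit law comes from \<open>p_top\<close>, and (b \<sqinter> c)x = b(cx)
  from \<open>p_meet\<close> and associativity. Finally b1 = p b \<sqinter> 1 = p b.\<close>

lemma frame_over_with_action:
  assumes "frame B" "frame X" and p: "p \<in> frame_homs B X"
  shows "frame_over B (with_action B X p)"
proof -
  interpret B: frame B by fact
  interpret X: frame X by fact
  have closed: "p b \<in> carrier X" if "b \<in> carrier B" for b
    using p that by (auto simp: frame_homs_def)
  have p_sup: "p (\<Squnion>\<^bsub>B\<^esub>S) = \<Squnion>\<^bsub>X\<^esub>(p ` S)" if "S \<subseteq> carrier B" for S
    using p that by (simp add: frame_homs_def sup_pres_def)
  have p_meet: "p (b \<sqinter>\<^bsub>B\<^esub> c) = p b \<sqinter>\<^bsub>X\<^esub> p c" if "b \<in> carrier B" "c \<in> carrier B" for b c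
    using p that by (simp add: frame_homs_def meet_pres_def)
  have p_top: "p \<top>\<^bsub>B\<^esub> = \<top>\<^bsub>X\<^esub>"
    using p by (simp add: frame_homs_def)
  have sup_left: "p (\<Squnion>\<^bsub>B\<^esub>S) \<sqinter>\<^bsub>X\<^esub> x = \<Squnion>\<^bsub>X\<^esub>((\<lambda>b. act (with_action B X p) b x) ` S)"
    if "S \<subseteq> carrier B" "x \<in> carrier X" for S x
  proof -
    have "p (\<Squnion>\<^bsub>B\<^esub>S) \<sqinter>\<^bsub>X\<^esub> x = \<Squnion>\<^bsub>X\<^esub>((\<lambda>a. a \<sqinter>\<^bsub>X\<^esub> x) ` p ` S)"
      using that closed by (subst X.sup_meet_distrib[symmetric]) (auto simp: p_sup)
    \<comment> \<open>All arguments lie in the carriers, where the restrictions in the action have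
      no effect.\<close>
    also have "(\<lambda>a. a \<sqinter>\<^bsub>X\<^esub> x) ` p ` S = (\<lambda>b. act (with_action B X p) b x) ` S"
      unfolding image_image using that by (intro image_cong) auto
    finally show ?thesis .
  qed
  have sup_right: "p b \<sqinter>\<^bsub>X\<^esub> \<Squnion>\<^bsub>X\<^esub>A = \<Squnion>\<^bsub>X\<^esub>(act (with_action B X p) b ` A)"
    if "b \<in> carrier B" "A \<subseteq> carrier X" for b A
  proof -
    have "act (with_action B X p) b ` A = (\<lambda>a. p b \<sqinter>\<^bsub>X\<^esub> a) ` A"
      using that by (intro image_cong) auto
    then show ?thesis
      using that closed by (simp add: X.meet_sup_distrib)
  qed
  have "frame_module B (with_action B X p)"
  proof (intro frame_module.intro frame_module_axioms.intro)
    show "complete_lattice (with_action B X p)"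
      by (simp add: X.complete_lattice_axioms)
  next
    show "act (with_action B X p)
        \<in> carrier B \<rightarrow>\<^sub>E carrier (with_action B X p) \<rightarrow>\<^sub>E carrier (with_action B X p)"
      using closed by auto
  next
    fix S x assume "S \<subseteq> carrier B" "x \<in> carrier (with_action B X p)"
    then show "act (with_action B X p) (\<Squnion>\<^bsub>B\<^esub>S) x =
        \<Squnion>\<^bsub>with_action B X p\<^esub>((\<lambda>b. act (with_action B X p) b x) ` S)"
      using sup_left by simp
  next
    fix b A assume "b \<in> carrier B" "A \<subseteq> carrier (with_action B X p)"
    then show "act (with_action B X p) b (\<Squnion>\<^bsub>with_action B X p\<^esub>A) =
        \<Squnion>\<^bsub>with_action B X p\<^esub>(act (with_action B X p) b ` A)"
      using sup_right by simp
  next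
    fix x assume "x \<in> carrier (with_action B X p)"
    then show "act (with_action B X p) \<top>\<^bsub>B\<^esub> x = x"
      using X.top_meet by (simp add: p_top X.eq_is_equal)
  next
    fix b c x
    assume "b \<in> carrier B" "c \<in> carrier B" "x \<in> carrier (with_action B X p)"
    then show "act (with_action B X p) (b \<sqinter>\<^bsub>B\<^esub> c) x =
        act (with_action B X p) b (act (with_action B X p) c x)"
      using closed by (simp add: p_meet X.meet_assoc)
  qed (fact \<open>frame B\<close>)
  then show ?thesis
    using \<open>frame X\<close> closed
    by (intro frame_over.intro frame_over_axioms.intro) (auto simp: X.meet_top)
qed

text \<open>The action is recovered on the carriers by \<open>act_eq_meet\<close>. Equality of
  records also needs agreement off the carriers, which \<open>act_ext\<close> provides.\<close>

lemma with_action_structure_hom: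
  assumes "frame_over B X"
  shows "with_action B (gorder.truncate X) (structure_hom B X) = X"
proof -
  interpret X: frame_over B X by fact
  have "act (with_action B (gorder.truncate X) (structure_hom B X)) b x = act X b x" for b x
  proof (cases "b \<in> carrier B")
    case True
    then have "act X b \<in> carrier X \<rightarrow>\<^sub>E carrier X"
      using X.act_ext by (rule PiE_mem[rotated])
    then have "act X b x = undefined" if "x \<notin> carrier X"
      using that by (rule PiE_arb)
    with True show ?thesis
      by (auto simp: structure_hom_def X.act_eq_meet[symmetric])
  next
    \<comment> \<open>Here the whole function \<open>act X b\<close> is \<open>undefined\<close>,
      not just its values off \<open>carrier X\<close>.\<close>
    case False
    then have "act X b = undefined"
      by (rule PiE_arb[OF X.act_ext])
    with False show ?thesis
      by simp
  qed
  then have "act (with_action B (gorder.truncate X) (structure_hom B X)) = act X"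
    by blast
  then show ?thesis
    by (cases X) (simp add: with_action_def gorder.defs)
qed

text \<open>On \<open>carrier B\<close> this is p b \<sqinter> 1 = p b; elsewhere both sides are
  \<open>undefined\<close>.\<close>

lemma structure_hom_with_action:
  assumes "frame X" "p \<in> frame_homs B X"
  shows "structure_hom B (with_action B X p) = p"
proof -
  interpret X: frame X by fact
  have p: "p \<in> carrier B \<rightarrow>\<^sub>E carrier X"
    using assms(2) by (rule frame_homsD)
  show ?thesis
  proof
    fix b
    have "p b \<in> carrier X" if "b \<in> carrier B"
      using p that by (rule PiE_mem)
    moreover have "p b = undefined" if "b \<notin> carrier B"
      using p that by (rule PiE_arb)
    ultimately show "structure_hom B (with_action B X p) b = p b"
      by (simp add: structure_hom_def X.meet_top)
  qed
qed

section \<open>Module homomorphisms and commuting triangles over \<open>B\<close>\<close>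

text \<open>h(b1) = b h(1) = b1. This is the triangle that makes \<open>h\<close> an arrow of the
  slice.\<close>

lemma compose_structure_hom:
  assumes "frame_over B Y" "h \<in> frame_homs Y X" "h \<in> frame_module_homs B Y X"
  shows "compose (carrier B) h (structure_hom B Y) = structure_hom B X"
proof -
  interpret Y: frame_over B Y by fact
  show ?thesis
    using assms(2,3)
    by (auto simp: fun_eq_iff compose_def structure_hom_def frame_homs_def frame_module_homs_def)
qed

text \<open>By the triangle, h(q b \<sqinter> x) = h(q b) \<sqinter> h x = p b \<sqinter> h
  x.\<close>

lemma frame_module_homs_with_action:
  assumes q: "q \<in> frame_homs B Y" and h: "h \<in> frame_homs Y X"
    and p: "compose (carrier B) h q = p"
  shows "h \<in> frame_module_homs B (with_action B Y q) (with_action B X p)"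
proof -
  have "sup_pres (with_action B Y q) (with_action B X p) h"
    using h by (simp add: frame_homs_def sup_pres_def)
  moreover have "q b \<in> carrier Y" if "b \<in> carrier B" for b
    using q that by (auto simp: frame_homs_def)
  moreover have "p b = h (q b)" if "b \<in> carrier B" for b
    using p that by (auto simp: compose_eq)
  ultimately show ?thesis
    using h by (auto simp: frame_module_homs_def frame_homs_def meet_pres_def PiE_mem)
qed

theorem theorem2p3:
  fixes B :: "'a gorder"
  assumes "frame B"
  shows "isomorphic_cats (BLoc B :: (('a, 'a) act_order, 'a \<Rightarrow> 'a) cat) (slice Loc B)"
proof -
  define Fo :: "('a, 'a) act_order \<Rightarrow> 'a gorder \<times> ('a \<Rightarrow> 'a)"
    where "Fo X = (gorder.truncate X, structure_hom B X)" for X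
  define Go :: "'a gorder \<times> ('a \<Rightarrow> 'a) \<Rightarrow> ('a, 'a) act_order"
    where "Go = (\<lambda>(X, p). with_action B X p)"
  \<comment> \<open>The carriers of \<open>B\<close> and of the \<open>B\<close>-locales lie in the
    same type, so \<open>B\<close> is itself an object of \<open>Loc\<close>.\<close>
  have slice: "category (slice Loc B)"
    using assms by (intro category_slice category_Loc) (simp add: Loc_def)
  \<comment> \<open>\<open>Fo\<close> keeps carriers, so identities and composites agree literally;
    what remains is that objects and arrows land in the slice.\<close>
  have "cat_functor (BLoc B) (slice Loc B) Fo (\<lambda>X Y f. f)"
    by (intro cat_functor.intro cat_functor_axioms.intro category_BLoc slice)
      (auto simp: Fo_def BLoc_def slice_def Loc_def structure_hom_in_frame_homs
        compose_structure_hom frame_over_def[of B])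
  moreover have "cat_functor (slice Loc B) (BLoc B) Go (\<lambda>X Y f. f)"
    by (intro cat_functor.intro cat_functor_axioms.intro category_BLoc slice)
      (auto simp: Go_def BLoc_def slice_def Loc_def frame_over_with_action assms
        frame_module_homs_with_action)
  moreover have "Go (Fo X) = X" if "X \<in> Ob (BLoc B)" for X
    using that by (simp add: Fo_def Go_def BLoc_def with_action_structure_hom)
  moreover have "Fo (Go X) = X" if "X \<in> Ob (slice Loc B)" for X
    using that by (auto simp: Fo_def Go_def slice_def Loc_def structure_hom_with_action)
  ultimately show ?thesis
    unfolding isomorphic_cats_def
    by (intro exI[of _ Fo] exI[of _ Go] exI[of _ "\<lambda>X Y f. f"]) simp
qed

end
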